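(* Let $n\ge 3$ be an integer. Let $\mathcal{R}$ be a system of representatives (in integers coprime to $n$) of the group $(\mathbb{Z}/n\mathbb{Z})^{\times}/\{\pm 1\}$, ordered in some fixed way. For an integer $k$ with $\gcd(k,n)=1$, let $k^*$ denote an integer with $kk^*\equiv 1 \pmod n$, and put $c_k=2\cos(2\pi k/n)$. Define the cosine matrix $C=(c_{jk^*})_{j,k\in\mathcal{R}}$. For integers $k$ with $\gcd(k,n)=1$ define $$\lambda(k)=\#\{q\in\mathbb{N} : q\ge 3,\ q\mid n,\ k\equiv 1 \pmod q\},$$ let $\rho_n=2$ if $n$ is odd and $\rho_n=4$ if $n$ is even, and put $$\widehat{c}_k=\frac1n\sum_{l\in\mathcal{R}}\bigl(\lambda(lk)+\lambda(-lk)+\rho_n\bigr)c_l .$$ Then $C$ is invertible if and only if $n$ is square-free. In this case $$C^{-1}=(\widehat{c}_{jk^*})_{j,k\in\mathcal{R}}.$$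
   Context: The quantities $c_{jk^*}$ and $\widehat c_{jk^*}$ depend only on $jk^*$ modulo $n$, so they do not depend on the choice of the inverse $k^*$. *)

theory Defs
  imports
    "HOL-Number_Theory.Residues"
    "HOL-Computational_Algebra.Squarefree"
    Complex_Main
    "Jordan_Normal_Form.Matrix"
begin

definition unit_residues :: "nat \<Rightarrow> int monoid" where
  "unit_residues n = units_of (residue_ring (int n))"

(* The subgroup {1, -1}, written with the canonical residues in {0..n-1}. *)
definition pm_one :: "nat \<Rightarrow> int set" where
  "pm_one n = {1 mod int n, (- 1) mod int n}"

definition rep_system :: "nat \<Rightarrow> int set \<Rightarrow> bool" where
  "rep_system n R \<longleftrightarrow>
     (\<forall>r\<in>R. coprime r (int n)) \<and>
     bij_betw (\<lambda>r. pm_one n #>\<^bsub>unit_residues n\<^esub> (r mod int n)) R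
       (carrier (unit_residues n Mod pm_one n))"

definition cosine_c :: "nat \<Rightarrow> int \<Rightarrow> real" where
  "cosine_c n k = 2 * cos (2 * pi * real_of_int k / real n)"

definition lambda_count :: "nat \<Rightarrow> int \<Rightarrow> nat" where
  "lambda_count n k = card {q::nat. q \<ge> 3 \<and> q dvd n \<and> [k = 1] (mod int q)}"

definition rho :: "nat \<Rightarrow> nat" where
  "rho n = (if odd n then 2 else 4)"

definition cosine_c_hat :: "nat \<Rightarrow> int set \<Rightarrow> int \<Rightarrow> real" where
  "cosine_c_hat n R k =
     1 / real n *
     (\<Sum>l\<in>R. real (lambda_count n (l * k) + lambda_count n (- l * k) + rho n) * cosine_c n l)"

(* The list rs is the ordered system of representatives; position i stands for rs ! i.
   The function star supplies the inverses modulo n. *)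
definition cosine_matrix :: "nat \<Rightarrow> int list \<Rightarrow> (int \<Rightarrow> int) \<Rightarrow> real mat" where
  "cosine_matrix n rs star =
     mat (length rs) (length rs) (\<lambda>(i, j). cosine_c n (rs ! i * star (rs ! j)))"

definition cosine_matrix_hat :: "nat \<Rightarrow> int list \<Rightarrow> (int \<Rightarrow> int) \<Rightarrow> real mat" where
  "cosine_matrix_hat n rs star =
     mat (length rs) (length rs) (\<lambda>(i, j). cosine_c_hat n (set rs) (rs ! i * star (rs ! j)))"

lemma carrier_unit_residues:
  assumes "n \<ge> 3"
  shows "carrier (unit_residues n) = {x. 0 < x \<and> x < int n \<and> coprime x (int n)}"
proof -
  interpret residues "int n" "residue_ring (int n)"
    using assms by unfold_locales auto
  show ?thesis
    unfolding unit_residues_def using res_units_eq by (simp add: units_of_carrier)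
qed

lemma mult_unit_residues: "x \<otimes>\<^bsub>unit_residues n\<^esub> y = (x * y) mod int n"
  by (simp add: unit_residues_def units_of_def residue_ring_def)

lemma coset_pm_one:
  "pm_one n #>\<^bsub>unit_residues n\<^esub> (r mod int n) = {r mod int n, (- r) mod int n}"
  by (auto simp: r_coset_def pm_one_def mult_unit_residues mod_simps)

lemma coset_pm_one_eq_iff:
  "pm_one n #>\<^bsub>unit_residues n\<^esub> (r mod int n) = pm_one n #>\<^bsub>unit_residues n\<^esub> (s mod int n)
     \<longleftrightarrow> [r = s] (mod int n) \<or> [r = - s] (mod int n)"
proof -
  have neg: "(- r) mod int n = (- s) mod int n" if "r mod int n = s mod int n" for r s
    using that by (metis mod_minus_eq)
  show ?thesis
    unfolding coset_pm_one cong_def doubleton_eq_iff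
    using neg[of r s] neg[of r "- s"] by auto
qed

lemma coprime_mod_unit_residues:
  assumes "n \<ge> 3" "coprime r (int n)"
  shows "r mod int n \<in> carrier (unit_residues n)"
proof -
  have c: "coprime (r mod int n) (int n)"
    using assms by (simp add: coprime_iff_gcd_eq_1)
  moreover have "r mod int n \<noteq> 0"
    using c assms by auto
  moreover have "r mod int n \<ge> 0" "r mod int n < int n"
    using assms by simp_all
  ultimately show ?thesis
    unfolding carrier_unit_residues[OF assms(1)] by simp
qed

lemma carrier_quotient:
  assumes "n \<ge> 3"
  shows "carrier (unit_residues n Mod pm_one n) =
    (\<lambda>k. pm_one n #>\<^bsub>unit_residues n\<^esub> (k mod int n)) ` {k. coprime k (int n)}"
proof -
  have "\<exists>k. coprime k (int n) \<and> x = k mod int n" if "x \<in> carrier (unit_residues n)" for x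
    using that unfolding carrier_unit_residues[OF assms] by (intro exI[of _ x]) auto
  thus ?thesis
    using coprime_mod_unit_residues[OF assms]
    by (fastforce simp: FactGroup_def RCOSETS_def)
qed

lemma rep_system_iff:
  assumes "n \<ge> 3"
  shows "rep_system n R \<longleftrightarrow>
    (\<forall>r\<in>R. coprime r (int n)) \<and>
    (\<forall>k. coprime k (int n) \<longrightarrow> (\<exists>!r. r \<in> R \<and> ([k = r] (mod int n) \<or> [k = - r] (mod int n))))"
    (is "_ \<longleftrightarrow> ?cop \<and> ?uniq")
proof -
  define f where "f = (\<lambda>k. pm_one n #>\<^bsub>unit_residues n\<^esub> (k mod int n))"
  have eq: "f k = f r \<longleftrightarrow> [k = r] (mod int n) \<or> [k = - r] (mod int n)" for k r
    unfolding f_def by (rule coset_pm_one_eq_iff)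
  have "bij_betw f R (f ` {k. coprime k (int n)}) \<longleftrightarrow> ?uniq" if cop: ?cop
  proof
    assume b: "bij_betw f R (f ` {k. coprime k (int n)})"
    hence inj: "inj_on f R" and im: "f ` R = f ` {k. coprime k (int n)}"
      by (auto simp: bij_betw_def)
    show ?uniq
      unfolding eq[symmetric]
    proof (intro allI impI)
      fix k assume "coprime k (int n)"
      then obtain r where "r \<in> R" "f k = f r"
        using im by (metis (mono_tags, lifting) imageE imageI mem_Collect_eq)
      thus "\<exists>!r. r \<in> R \<and> f k = f r"
        using inj by (metis inj_onD)
    qed
  next
    assume u: ?uniq
    hence u': "\<exists>!r. r \<in> R \<and> f k = f r" if "coprime k (int n)" for k
      using that unfolding eq[symmetric] by blast
    have "inj_on f R"
      using u' cop by (intro inj_onI) metis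
    moreover have "f ` R = f ` {k. coprime k (int n)}"
      using u' cop by blast
    ultimately show "bij_betw f R (f ` {k. coprime k (int n)})"
      by (simp add: bij_betw_def)
  qed
  thus ?thesis
    unfolding rep_system_def carrier_quotient[OF assms] f_def by blast
qed

lemma cosine_c_cong:
  assumes "[k = k'] (mod int n)"
  shows "cosine_c n k = cosine_c n k'"
proof (cases "n = 0")
  case False
  from assms obtain m where "k - k' = int n * m"
    by (auto simp: cong_iff_dvd_diff)
  hence "k = k' + int n * m" by simp
  hence "2 * pi * real_of_int k / real n = 2 * pi * real_of_int k' / real n + 2 * pi * real_of_int m"
    using False by (simp add: field_simps)
  thus ?thesis
    by (simp only: cosine_c_def cos_add cos_int_2pin sin_int_2pin) simp
qed (use assms in simp)

lemma cosine_c_hat_cong: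
  assumes "[k = k'] (mod int n)"
  shows "cosine_c_hat n R k = cosine_c_hat n R k'"
proof -
  have "lambda_count n (l * k) = lambda_count n (l * k')" for l
  proof -
    have "[l * k = 1] (mod int q) \<longleftrightarrow> [l * k' = 1] (mod int q)" if "q dvd n" for q
    proof -
      have "[l * k = l * k'] (mod int q)"
        using assms that by (meson cong_dvd_modulus cong_scalar_left int_dvd_int_iff)
      thus ?thesis by (metis cong_sym cong_trans)
    qed
    thus ?thesis
      unfolding lambda_count_def by (intro arg_cong[where f = card]) blast
  qed
  from this[of "- l" for l] this show ?thesis
    unfolding cosine_c_hat_def by simp
qed

end

theory Submission
  imports Defs "Jordan_Normal_Form.Determinant"
begin

text \<open>
  Write \<open>e(x) = exp(2\<pi>ix/n)\<close>, let \<open>r(x)\<close> be the Ramanujan sum of \<open>e(ux)\<close> over the units \<open>u\<close>, and let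
  \<open>\<Lambda>(k)\<close> be the number of all divisors \<open>q\<close> of \<open>n\<close> with \<open>k \<equiv> 1 (mod q)\<close>. The constant \<open>\<rho>\<close> accounts
  exactly for the divisors 1 and 2 omitted in \<open>\<lambda>\<close>, so that
  \<open>\<lambda>(k) + \<lambda>(-k) + \<rho> = \<Lambda>(k) + \<Lambda>(-k)\<close> for units \<open>k\<close>. Sums of even functions over the representatives are
  half sums over all units, and correlating two cosines over the units gives Ramanujan sums. Hence
  the product of the two matrices has the entries \<open>(S(k*,i) + S(-k*,i)) / n\<close> where
  \<open>S(a,b) = \<Sum>\<^sub>t \<Lambda>(ta) r(t - b)\<close>. For square-free \<open>n\<close> both \<open>\<Lambda>\<close> and \<open>r\<close> are products over the
  primes dividing \<open>n\<close>, so by the Chinese remainder theorem \<open>S\<close> factors into sums modulo primes, and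
  \<open>S(a,b)\<close> is \<open>n\<close> or 0 according to whether \<open>ab \<equiv> 1 (mod n)\<close>.

  If \<open>p\<^sup>2\<close> divides \<open>n\<close>, then the units \<open>1 + sn/p\<close> with \<open>s < p\<close> form a subgroup over each of whose
  cosets \<open>e\<close> sums to 0; counting, for each representative \<open>r\<close>, the elements of this subgroup inverse
  to \<open>r\<close> up to sign gives a nonzero kernel vector.
\<close>

section \<open>Units modulo \<open>n\<close> and sums of periodic functions over them\<close>

definition unit_reps :: "nat \<Rightarrow> int set" where
  "unit_reps n = {u. 0 \<le> u \<and> u < int n \<and> coprime u (int n)}"

definition periodic_mod :: "nat \<Rightarrow> (int \<Rightarrow> 'a) \<Rightarrow> bool" where
  "periodic_mod n f \<longleftrightarrow> (\<forall>x y. [x = y] (mod int n) \<longrightarrow> f x = f y)"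

definition add_char :: "nat \<Rightarrow> int \<Rightarrow> complex" where
  "add_char n k = cis (2 * pi * real_of_int k / real n)"

definition ramanujan_sum :: "nat \<Rightarrow> int \<Rightarrow> complex" where
  "ramanujan_sum n x = (\<Sum>u\<in>unit_reps n. add_char n (u * x))"

text \<open>Admitting the divisors 1 and 2, which \<open>lambda_count\<close> leaves out, makes the
  count multiplicative over coprime moduli.\<close>

definition cong_one_count :: "nat \<Rightarrow> int \<Rightarrow> nat" where
  "cong_one_count n k = card {q. q dvd n \<and> [k = 1] (mod int q)}"

lemma periodic_modD: "periodic_mod n f \<Longrightarrow> [x = y] (mod int n) \<Longrightarrow> f x = f y"
  by (simp add: periodic_mod_def)

lemma finite_unit_reps [simp]: "finite (unit_reps n)"
  by (rule finite_subset[of _ "{0..<int n}"]) (auto simp: unit_reps_def)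

lemma coprime_mod_left_iff: "n > 0 \<Longrightarrow> coprime (u mod int n) (int n) \<longleftrightarrow> coprime u (int n)"
  by (simp add: coprime_iff_gcd_eq_1)

lemma mod_in_unit_reps: "n > 0 \<Longrightarrow> coprime u (int n) \<Longrightarrow> u mod int n \<in> unit_reps n"
  by (simp add: unit_reps_def coprime_mod_left_iff)

lemma cong_unit_reps_eq: "u \<in> unit_reps n \<Longrightarrow> v \<in> unit_reps n \<Longrightarrow> [u = v] (mod int n) \<Longrightarrow> u = v"
  by (auto simp: unit_reps_def cong_def)

lemma coprime_unit_reps: "u \<in> unit_reps n \<Longrightarrow> coprime u (int n)"
  by (simp add: unit_reps_def)

text \<open>Followed by reduction modulo \<open>n\<close>, the map \<open>\<phi>\<close> becomes an
  injective self-map of a finite set, hence a permutation of the units, and a periodic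
  \<open>f\<close> does not see the reduction.\<close>

lemma sum_unit_reps_reindex:
  fixes f :: "int \<Rightarrow> 'a :: comm_monoid_add"
  assumes "n > 0" "periodic_mod n f"
    and "\<And>u. u \<in> unit_reps n \<Longrightarrow> coprime (\<phi> u) (int n)"
    and "\<And>u v. u \<in> unit_reps n \<Longrightarrow> v \<in> unit_reps n \<Longrightarrow> [\<phi> u = \<phi> v] (mod int n) \<Longrightarrow> [u = v] (mod int n)"
  shows "(\<Sum>u\<in>unit_reps n. f (\<phi> u)) = (\<Sum>u\<in>unit_reps n. f u)"
proof -
  let ?g = "\<lambda>u. \<phi> u mod int n"
  have inj: "inj_on ?g (unit_reps n)"
  proof (rule inj_onI)
    fix u v assume uv: "u \<in> unit_reps n" "v \<in> unit_reps n" "?g u = ?g v"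
    show "u = v"
      using assms(4)[OF uv(1,2)] uv cong_unit_reps_eq[OF uv(1,2)] by (simp add: cong_def)
  qed
  have "?g ` unit_reps n \<subseteq> unit_reps n"
    using assms(1,3) by (auto intro: mod_in_unit_reps)
  hence "?g ` unit_reps n = unit_reps n"
    using inj by (intro endo_inj_surj) auto
  hence "(\<Sum>u\<in>unit_reps n. f u) = (\<Sum>u\<in>unit_reps n. f (?g u))"
    using sum.reindex[OF inj, of f] by simp
  also have "\<dots> = (\<Sum>u\<in>unit_reps n. f (\<phi> u))"
    by (intro sum.cong refl periodic_modD[OF assms(2)]) (simp add: cong_def)
  finally show ?thesis ..
qed

lemma sum_unit_reps_mult:
  fixes f :: "int \<Rightarrow> 'a :: comm_monoid_add"
  assumes "n > 0" "periodic_mod n f" "coprime a (int n)"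
  shows "(\<Sum>u\<in>unit_reps n. f (u * a)) = (\<Sum>u\<in>unit_reps n. f u)"
  using assms(1,2)
  by (rule sum_unit_reps_reindex) (use assms(3) in \<open>auto simp: coprime_unit_reps cong_mult_rcancel\<close>)

lemma sum_unit_reps_uminus:
  fixes f :: "int \<Rightarrow> 'a :: comm_monoid_add"
  assumes "n > 0" "periodic_mod n f"
  shows "(\<Sum>u\<in>unit_reps n. f (- u)) = (\<Sum>u\<in>unit_reps n. f u)"
  using sum_unit_reps_mult[OF assms, of "-1"] by simp

lemma sum_unit_reps_inverse:
  fixes f :: "int \<Rightarrow> 'a :: comm_monoid_add"
  assumes "n > 0" "periodic_mod n f"
    and star: "\<And>k. coprime k (int n) \<Longrightarrow> [k * star k = 1] (mod int n)"
  shows "(\<Sum>u\<in>unit_reps n. f (star u)) = (\<Sum>u\<in>unit_reps n. f u)"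
  using assms(1,2)
proof (rule sum_unit_reps_reindex)
  fix u assume "u \<in> unit_reps n"
  thus "coprime (star u) (int n)"
    using star[of u] by (metis coprime_iff_invertible_int coprime_unit_reps mult.commute)
next
  fix u v assume uv: "u \<in> unit_reps n" "v \<in> unit_reps n" "[star u = star v] (mod int n)"
  \<comment> \<open>Inversion is injective: once the inverses of u and v agree, inserting one of
    them into the product u v gives back u as well as v.\<close>
  have "[u = u * (v * star v)] (mod int n)"
    using cong_scalar_left[OF star[of v], of u] uv by (simp add: coprime_unit_reps cong_sym)
  also have "u * (v * star v) = (u * v) * star v"
    by (simp add: mult_ac)
  also have "[\<dots> = (u * v) * star u] (mod int n)"
    by (rule cong_scalar_left[OF cong_sym[OF uv(3)]])
  also have "(u * v) * star u = v * (u * star u)"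
    by (simp add: mult_ac)
  also have "[\<dots> = v * 1] (mod int n)"
    using uv by (intro cong_scalar_left star coprime_unit_reps)
  finally show "[u = v] (mod int n)" by simp
qed

text \<open>By the Chinese remainder theorem, reduction modulo \<open>a\<close> and modulo
  \<open>b\<close> identifies the units modulo \<open>a * b\<close> with pairs of units, and the
  product of the two sums runs over such pairs.\<close>

lemma sum_unit_reps_coprime_mult:
  fixes f g :: "int \<Rightarrow> 'a :: comm_semiring_0"
  assumes "a > 0" "b > 0" "coprime a b" "periodic_mod a f" "periodic_mod b g"
  shows "(\<Sum>t\<in>unit_reps (a * b). f t * g t) = (\<Sum>t\<in>unit_reps a. f t) * (\<Sum>t\<in>unit_reps b. g t)"
proof -
  let ?h = "\<lambda>t. (t mod int a, t mod int b)"
  have cop: "coprime (int a) (int b)" using assms(3) by simp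
  have inj: "inj_on ?h (unit_reps (a * b))"
  proof (rule inj_onI)
    fix u v assume uv: "u \<in> unit_reps (a * b)" "v \<in> unit_reps (a * b)" "?h u = ?h v"
    have "[u = v] (mod int a * int b)"
      using uv(3) by (intro coprime_cong_mult cop) (simp_all add: cong_def)
    thus "u = v" using cong_unit_reps_eq[OF uv(1,2)] by simp
  qed
  have im: "?h ` unit_reps (a * b) = unit_reps a \<times> unit_reps b"
  proof (intro equalityI subsetI)
    fix x assume "x \<in> unit_reps a \<times> unit_reps b"
    then obtain u v where x: "x = (u, v)" "u \<in> unit_reps a" "v \<in> unit_reps b" by auto
    obtain t where t: "[t = u] (mod int a)" "[t = v] (mod int b)"
      using binary_chinese_remainder_int[OF cop] by blast
    have "coprime t (int a)" "coprime t (int b)"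
      using t x by (metis cong_imp_coprime cong_sym coprime_unit_reps)+
    hence "t mod int (a * b) \<in> unit_reps (a * b)"
      using assms(1,2) by (intro mod_in_unit_reps) auto
    moreover have "x = ?h (t mod int (a * b))"
      using t x assms(1,2) by (auto simp: mod_mod_cancel cong_def unit_reps_def)
    ultimately show "x \<in> ?h ` unit_reps (a * b)" by (rule rev_image_eqI)
  next
    fix x assume "x \<in> ?h ` unit_reps (a * b)"
    then obtain t where t: "x = ?h t" "coprime t (int (a * b))" by (auto simp: unit_reps_def)
    hence "coprime t (int a)" "coprime t (int b)" by simp_all
    thus "x \<in> unit_reps a \<times> unit_reps b"
      using assms(1,2) by (simp add: t(1) mod_in_unit_reps)
  qed
  have "(\<Sum>t\<in>unit_reps a. f t) * (\<Sum>t\<in>unit_reps b. g t) = (\<Sum>(u,v)\<in>unit_reps a \<times> unit_reps b. f u * g v)"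
    by (simp add: sum_product sum.cartesian_product)
  also have "\<dots> = (\<Sum>t\<in>unit_reps (a * b). f (t mod int a) * g (t mod int b))"
    unfolding im[symmetric] by (subst sum.reindex[OF inj]) simp
  also have "\<dots> = (\<Sum>t\<in>unit_reps (a * b). f t * g t)"
    by (intro sum.cong refl arg_cong2[where f = "(*)"] periodic_modD[OF assms(4)] periodic_modD[OF assms(5)])
       (simp_all add: cong_def)
  finally show ?thesis ..
qed

section \<open>Additive characters and Ramanujan sums\<close>

lemma add_char_add: "add_char n (x + y) = add_char n x * add_char n y"
  by (simp add: add_char_def cis_mult add_divide_distrib distrib_left)

lemma add_char_0 [simp]: "add_char n 0 = 1"
  by (simp add: add_char_def)

lemma add_char_eq_1_iff:
  assumes "n > 0"
  shows "add_char n x = 1 \<longleftrightarrow> int n dvd x"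
proof
  assume "add_char n x = 1"
  hence "cos (2 * pi * real_of_int x / real n) = 1"
    by (simp add: add_char_def complex_eq_iff)
  then obtain m :: int where "2 * pi * real_of_int x / real n = real_of_int m * 2 * pi"
    by (auto simp: cos_one_2pi_int)
  hence "real_of_int x = real_of_int (m * int n)"
    using assms by (simp add: field_simps)
  thus "int n dvd x" by (simp only: of_int_eq_iff) simp
next
  assume "int n dvd x"
  then obtain m where "x = int n * m" by auto
  thus "add_char n x = 1"
    using assms cis_multiple_2pi[of "real_of_int m"] by (simp add: add_char_def mult_ac)
qed

lemma periodic_add_char: "n > 0 \<Longrightarrow> periodic_mod n (add_char n)"
  unfolding periodic_mod_def
proof (intro allI impI)
  fix x y assume "n > 0" "[x = y] (mod int n)"
  hence "add_char n (x - y) = 1" by (simp add: add_char_eq_1_iff cong_iff_dvd_diff)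
  thus "add_char n x = add_char n y" using add_char_add[of n "x - y" y] by simp
qed

lemma periodic_compose:
  assumes "periodic_mod n f" "\<And>x y. [x = y] (mod int n) \<Longrightarrow> [g x = g y] (mod int n)"
  shows "periodic_mod n (\<lambda>x. f (g x))"
  using assms by (simp add: periodic_mod_def)

lemma add_char_power: "add_char n x ^ k = add_char n (int k * x)"
  by (simp add: add_char_def Complex.DeMoivre mult_ac)

text \<open>A geometric series whose ratio \<open>add_char n x\<close> is an n-th root of unity,
  equal to 1 only when \<open>n\<close> divides \<open>x\<close>.\<close>

lemma sum_add_char:
  assumes "n > 0"
  shows "(\<Sum>s<n. add_char n (int s * x)) = (if int n dvd x then of_nat n else 0)"
proof (cases "int n dvd x")
  case True
  hence "add_char n (int s * x) = 1" for s using assms by (simp add: add_char_eq_1_iff)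
  thus ?thesis using True by simp
next
  case False
  hence "add_char n x \<noteq> 1" using assms by (simp add: add_char_eq_1_iff)
  moreover have "add_char n x ^ n = 1" using assms by (simp add: add_char_power add_char_eq_1_iff)
  ultimately show ?thesis
    using False geometric_sum[of "add_char n x" n] by (simp add: add_char_power)
qed

lemma unit_reps_prime:
  assumes "prime p"
  shows "unit_reps p = int ` {1..<p}"
proof -
  have "u \<in> unit_reps p \<longleftrightarrow> u \<in> {1..<int p}" for u
  proof -
    have "prime (int p)" using assms by simp
    hence "coprime u (int p) \<longleftrightarrow> \<not> int p dvd u"
      using prime_imp_coprime[of "int p" u] not_prime_unit[of "int p"]
      by (auto simp: coprime_commute coprime_absorb_left)
    moreover have "\<not> int p dvd u" if "0 < u" "u < int p"
      using that zdvd_imp_le[of "int p" u] by auto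
    moreover have "u \<noteq> 0" if "\<not> int p dvd u" using that by auto
    ultimately show ?thesis by (auto simp: unit_reps_def)
  qed
  hence "unit_reps p = {1..<int p}" by blast
  thus ?thesis using image_int_atLeastLessThan[of 1 p] by simp
qed

text \<open>Modulo a prime only the residue 0 is not a unit, so this is the full character sum
  without its term 1 at 0.\<close>

lemma ramanujan_sum_prime:
  assumes "prime p"
  shows "ramanujan_sum p x = (if int p dvd x then of_nat p else 0) - 1"
proof -
  have p: "p > 0" using assms by (simp add: prime_gt_0_nat)
  have "ramanujan_sum p x = (\<Sum>s\<in>{1..<p}. add_char p (int s * x))"
    unfolding ramanujan_sum_def unit_reps_prime[OF assms] by (simp add: sum.reindex)
  also have "{1..<p} = {..<p} - {0}" by auto
  also have "(\<Sum>s\<in>\<dots>. add_char p (int s * x)) = (\<Sum>s<p. add_char p (int s * x)) - 1"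
    using p by (subst sum_diff1) auto
  finally show ?thesis unfolding sum_add_char[OF p] .
qed

lemma add_char_mult_cancel: "a > 0 \<Longrightarrow> add_char (a * b) (int a * x) = add_char b x"
  by (simp add: add_char_def mult.assoc)

text \<open>A Bezout relation splits the character modulo \<open>a * b\<close> into one modulo
  \<open>a\<close> and one modulo \<open>b\<close>, twisted by the Bezout coefficients. These are
  units for the respective moduli, so the twists disappear when the two sums are reindexed.\<close>

lemma ramanujan_sum_coprime_mult:
  assumes "a > 0" "b > 0" "coprime a b"
  shows "ramanujan_sum (a * b) x = ramanujan_sum a x * ramanujan_sum b x"
proof -
  obtain a' b' where ab: "int a * a' + int b * b' = 1"
    using assms(3) bezout_int[of "int a" "int b"] by (auto simp: mult.commute)
  have cop: "coprime b' (int a)" "coprime a' (int b)"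
  proof -
    have "[b' * int b = 1] (mod int a)" "[a' * int a = 1] (mod int b)"
      unfolding cong_iff_dvd_diff ab[symmetric] by (simp_all add: algebra_simps)
    thus "coprime b' (int a)" "coprime a' (int b)"
      unfolding coprime_iff_invertible_int by blast+
  qed
  have split: "add_char (a * b) (u * x) = add_char a (u * b' * x) * add_char b (u * a' * x)" for u
  proof -
    have "u * x = u * x * (int a * a' + int b * b')" using ab by simp
    also have "\<dots> = int b * (u * b' * x) + int a * (u * a' * x)" by (simp add: algebra_simps)
    finally have *: "u * x = int b * (u * b' * x) + int a * (u * a' * x)" .
    show ?thesis
      unfolding * add_char_add add_char_mult_cancel[OF assms(1)]
      unfolding mult.commute[of a b] add_char_mult_cancel[OF assms(2)] ..
  qed
  have per: "periodic_mod c (\<lambda>u. add_char c (u * d * x))" if "c > 0" for c d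
    unfolding mult.assoc by (rule periodic_compose[OF periodic_add_char[OF that]]) (rule cong_scalar_right)
  have "ramanujan_sum (a * b) x =
      (\<Sum>u\<in>unit_reps a. add_char a (u * b' * x)) * (\<Sum>u\<in>unit_reps b. add_char b (u * a' * x))"
    unfolding ramanujan_sum_def split by (intro sum_unit_reps_coprime_mult assms per)
  also have "\<dots> = ramanujan_sum a x * ramanujan_sum b x"
    unfolding ramanujan_sum_def
      sum_unit_reps_mult[OF assms(1) per[OF assms(1), of 1] cop(1), unfolded mult_1_right]
      sum_unit_reps_mult[OF assms(2) per[OF assms(2), of 1] cop(2), unfolded mult_1_right] ..
  finally show ?thesis .
qed

lemma periodic_ramanujan_sum: "n > 0 \<Longrightarrow> periodic_mod n (ramanujan_sum n)"
  unfolding periodic_mod_def ramanujan_sum_def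
  by (intro allI impI sum.cong refl periodic_modD[OF periodic_add_char] cong_scalar_left)

lemma ramanujan_sum_uminus: "n > 0 \<Longrightarrow> ramanujan_sum n (- x) = ramanujan_sum n x"
proof -
  assume n: "n > 0"
  have "periodic_mod n (\<lambda>u. add_char n (u * x))"
    by (rule periodic_compose[OF periodic_add_char[OF n]]) (rule cong_scalar_right)
  from sum_unit_reps_uminus[OF n this] show ?thesis
    by (simp add: ramanujan_sum_def)
qed

section \<open>Counting the divisors q of the modulus with k \<equiv> 1 (mod q)\<close>

lemma periodic_cong_one_count: "periodic_mod n (cong_one_count n)"
proof -
  have "[x = 1] (mod int q) \<longleftrightarrow> [y = 1] (mod int q)" if "[x = y] (mod int n)" "q dvd n" for x y q
  proof -
    have "[x = y] (mod int q)"
      using that by (auto intro: cong_dvd_modulus[of x y "int n"])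
    thus ?thesis by (simp add: cong_def)
  qed
  thus ?thesis
    unfolding periodic_mod_def cong_one_count_def
    by (intro allI impI arg_cong[where f = card]) blast
qed

text \<open>The divisors of \<open>p * m\<close> are the divisors d of \<open>m\<close> together
  with the products p d. The two families are disjoint, and p d is counted exactly when k is 1
  modulo both p and d.\<close>

lemma cong_one_count_prime_mult:
  assumes "prime p" "m > 0" "coprime p m"
  shows "cong_one_count (p * m) k = (if [k = 1] (mod int p) then 2 else 1) * cong_one_count m k"
proof -
  let ?D = "{q. q dvd m \<and> [k = 1] (mod int q)}"
  have p: "p > 0" using assms(1) by (simp add: prime_gt_0_nat)
  have fin: "finite ?D" using assms(2) by (intro finite_subset[OF _ finite_divisors_nat[of m]]) auto
  have eq: "{q. q dvd p * m \<and> [k = 1] (mod int q)} =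
      ?D \<union> (if [k = 1] (mod int p) then (*) p ` ?D else {})" (is "?A = ?B")
  proof (intro equalityI subsetI)
    fix q assume q: "q \<in> ?A"
    show "q \<in> ?B"
    proof (cases "p dvd q")
      case True
      then obtain d where d: "q = p * d" by auto
      hence "d dvd m" using q p by simp
      moreover have "[k = 1] (mod int p)" "[k = 1] (mod int d)"
        using q d by (metis (mono_tags, lifting) cong_dvd_modulus dvd_triv_left dvd_triv_right mem_Collect_eq of_nat_mult)+
      ultimately show ?thesis using d by auto
    next
      case False
      hence "coprime q p" using assms(1) by (metis coprime_commute prime_imp_coprime)
      thus ?thesis using q by (auto simp: coprime_dvd_mult_right_iff)
    qed
  next
    fix q assume q: "q \<in> ?B"
    show "q \<in> ?A"
    proof (cases "q \<in> ?D")
      case False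
      then obtain d where d: "q = p * d" "d dvd m" "[k = 1] (mod int d)" "[k = 1] (mod int p)"
        using q by (auto split: if_splits)
      have "coprime (int p) (int d)" using assms(3) d(2)
        by (metis coprime_divisors coprime_int_iff dvd_refl)
      thus ?thesis using d by (auto intro: coprime_cong_mult)
    qed auto
  qed
  have "?D \<inter> (*) p ` ?D = {}"
    using assms(1,3) by (auto dest!: coprime_common_divisor_nat[of p m p] dvd_mult_left simp: not_prime_1)
  moreover have "card ((*) p ` ?D) = card ?D"
    using p by (intro card_image inj_onI) auto
  ultimately show ?thesis
    unfolding cong_one_count_def eq using fin by (auto simp: card_Un_disjoint)
qed

lemma cong_one_count_1 [simp]: "cong_one_count (Suc 0) k = 1"
proof -
  have "{q. q dvd Suc 0 \<and> [k = 1] (mod int q)} = {1}" by auto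
  thus ?thesis by (simp add: cong_one_count_def)
qed

lemma cong_one_count_prime:
  assumes "prime p"
  shows "cong_one_count p k = (if [k = 1] (mod int p) then 2 else 1)"
  using cong_one_count_prime_mult[OF assms, of 1 k] by simp

section \<open>The convolution of the divisor count with the Ramanujan sum\<close>

lemma unit_reps_1 [simp]: "unit_reps (Suc 0) = {0}"
  by (auto simp: unit_reps_def)

text \<open>Let c be the inverse of \<open>a\<close> and d the residue of \<open>b\<close>. The
  count is 1 plus a spike at t = c, and the Ramanujan sum is p times a spike at t = d, minus 1. The
  constant part of the count contributes p - (p - 1) = 1, and its spike contributes p - 1 or -1
  according to whether c = d.\<close>

lemma convolution_prime:
  assumes "prime p" "coprime a (int p)" "coprime b (int p)"
  shows "(\<Sum>t\<in>unit_reps p. of_nat (cong_one_count p (t * a)) * ramanujan_sum p (t - b)) =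
    (if [a * b = 1] (mod int p) then of_nat p else 0)"
proof -
  have p: "p > 0" using assms(1) by (simp add: prime_gt_0_nat)
  obtain a' where a': "[a * a' = 1] (mod int p)"
    using assms(2) cong_solve_coprime_int by blast
  define c where "c = a' mod int p"
  define d where "d = b mod int p"
  have ac: "[a * c = 1] (mod int p)" using a' by (simp add: c_def cong_def mod_mult_right_eq)
  have c: "c \<in> unit_reps p"
    unfolding c_def using p a' by (intro mod_in_unit_reps) (metis coprime_iff_invertible_int mult.commute)+
  have d: "d \<in> unit_reps p" unfolding d_def using p assms(3) by (intro mod_in_unit_reps)
  have tc: "[t * a = 1] (mod int p) \<longleftrightarrow> t = c" if "t \<in> unit_reps p" for t
  proof
    assume "[t * a = 1] (mod int p)"
    hence "[t * a = c * a] (mod int p)" using ac by (metis cong_sym cong_trans mult.commute)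
    thus "t = c" using assms(2) that c by (auto simp: cong_mult_rcancel intro: cong_unit_reps_eq)
  qed (use ac in \<open>simp add: mult.commute\<close>)
  have td: "int p dvd t - b \<longleftrightarrow> t = d" if "t \<in> unit_reps p" for t
    using that d cong_unit_reps_eq[OF that d]
    by (auto simp: cong_iff_dvd_diff[symmetric] d_def cong_def)
  have cd: "[a * b = 1] (mod int p) \<longleftrightarrow> c = d"
  proof -
    have "[a * b = 1] (mod int p) \<longleftrightarrow> [d * a = 1] (mod int p)"
      by (simp add: d_def cong_def mult.commute mod_mult_right_eq)
    thus ?thesis using tc[OF d] by auto
  qed
  have "(\<Sum>t\<in>unit_reps p. of_nat (cong_one_count p (t * a)) * ramanujan_sum p (t - b)) =
    (\<Sum>t\<in>unit_reps p. (if t = d then of_nat p else 0) - 1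
        + (if t = c then (if c = d then of_nat p else 0) - 1 else (0 :: complex)))"
    by (intro sum.cong refl) (simp add: cong_one_count_prime[OF assms(1)] ramanujan_sum_prime[OF assms(1)] tc td)
  also have "\<dots> = of_nat p - of_nat (card (unit_reps p)) + ((if c = d then of_nat p else 0) - 1)"
    using c d by (simp add: sum.distrib sum_subtractf sum.delta)
  also have "card (unit_reps p) = p - 1"
    by (simp add: unit_reps_prime[OF assms(1)] card_image)
  finally show ?thesis using p by (simp add: cd of_nat_diff)
qed

text \<open>One prime is split off at a time: square-freeness makes it coprime to the cofactor, both
  factors of the summand are then multiplicative, and the sum splits by the Chinese remainder
  theorem.\<close>

lemma convolution_squarefree:
  assumes "squarefree n" "coprime a (int n)" "coprime b (int n)"
  shows "(\<Sum>t\<in>unit_reps n. of_nat (cong_one_count n (t * a)) * ramanujan_sum n (t - b)) =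
    (if [a * b = 1] (mod int n) then of_nat n else 0)"
  using assms
proof (induction n rule: less_induct)
  case (less n)
  show ?case
  proof (cases "n = 1")
    \<comment> \<open>Modulo 1 the residue 0 counts as a unit, so the sum has the single term
      1.\<close>
    case True
    thus ?thesis by (simp add: ramanujan_sum_def)
  next
    case False
    then obtain p where p: "prime p" "p dvd n" by (meson prime_factor_nat)
    then obtain m where n: "n = p * m" by auto
    have n0: "n > 0" using less.prems(1) by (auto intro: Nat.gr0I)
    have m: "m > 0" "m < n" "p > 0" using n n0 prime_gt_1_nat[OF p(1)] by auto
    have sq: "squarefree m" using less.prems(1) n by (intro squarefree_mono[of m n]) auto
    have cop: "coprime p m"
    proof (rule ccontr)
      assume "\<not> coprime p m"
      hence "p dvd m" using p(1) by (metis prime_imp_coprime)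
      hence "p ^ 2 dvd n" unfolding n by (simp add: power2_eq_square)
      thus False using less.prems(1) p(1) unfolding squarefree_def by (meson not_prime_unit)
    qed
    have copab: "coprime a (int p)" "coprime a (int m)" "coprime b (int p)" "coprime b (int m)"
      using less.prems(2,3) n by auto
    let ?F = "\<lambda>n t. of_nat (cong_one_count n (t * a)) * ramanujan_sum n (t - b) :: complex"
    have per: "periodic_mod k (?F k)" if "k > 0" for k
      unfolding periodic_mod_def
      by (intro allI impI arg_cong2[where f = "(*)"] arg_cong[where f = of_nat]
           periodic_modD[OF periodic_cong_one_count] periodic_modD[OF periodic_ramanujan_sum[OF that]])
         (auto intro: cong_mult cong_diff)
    have "(\<Sum>t\<in>unit_reps n. ?F n t) = (\<Sum>t\<in>unit_reps (p * m). ?F p t * ?F m t)"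
      unfolding n cong_one_count_prime_mult[OF p(1) m(1) cop] cong_one_count_prime[OF p(1)]
        ramanujan_sum_coprime_mult[OF m(3,1) cop] by (simp add: mult_ac)
    also have "\<dots> = (\<Sum>t\<in>unit_reps p. ?F p t) * (\<Sum>t\<in>unit_reps m. ?F m t)"
      by (intro sum_unit_reps_coprime_mult m cop per)
    also have "\<dots> = (if [a * b = 1] (mod int p) \<and> [a * b = 1] (mod int m) then of_nat n else 0)"
      unfolding convolution_prime[OF p(1) copab(1,3)] less.IH[OF m(2) sq copab(2,4)] by (simp add: n)
    also have "[a * b = 1] (mod int p) \<and> [a * b = 1] (mod int m) \<longleftrightarrow> [a * b = 1] (mod int n)"
      using coprime_cong_mult[of "a * b" 1 "int p" "int m"] cop unfolding n
      by (metis cong_modulus_mult coprime_int_iff mult.commute of_nat_mult)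
    finally show ?thesis .
  qed
qed

section \<open>Cosines, and sums over representatives as half sums over all units\<close>

lemma cosine_c_conv_add_char: "of_real (cosine_c n k) = add_char n k + add_char n (- k)"
  by (simp add: cosine_c_def add_char_def complex_eq_iff)

lemma cosine_c_uminus: "cosine_c n (- k) = cosine_c n k"
  by (simp add: cosine_c_def)

text \<open>The divisors below 3 always satisfy the congruence: 1 trivially, and 2 because units
  modulo an even number are odd. So \<open>rho n\<close> is twice their number. The equation is
  doubled because a single \<open>rho n\<close> has to serve both k and -k.\<close>

lemma cong_one_count_conv_lambda_count:
  assumes "n > 0" "coprime k (int n)"
  shows "2 * cong_one_count n k = 2 * lambda_count n k + rho n"
proof -
  let ?A = "{q. q \<ge> 3 \<and> q dvd n \<and> [k = 1] (mod int q)}"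
  let ?B = "if odd n then {1} else {1, 2 :: nat}"
  have fin: "finite ?A"
    using assms(1) by (intro finite_subset[OF _ finite_divisors_nat[of n]]) auto
  have small: "q \<in> ?B \<longleftrightarrow> q < 3 \<and> q dvd n" for q :: nat
  proof -
    have "q < 3 \<longleftrightarrow> q = 0 \<or> q = 1 \<or> q = 2" by auto
    thus ?thesis using assms(1) by auto
  qed
  have "[k = 1] (mod int q)" if "q \<in> ?B" for q
  proof (cases "q = 2")
    case True
    hence "even n" using that by (auto split: if_splits)
    hence "odd k" using assms(2) by (auto elim!: evenE)
    thus ?thesis using True by (simp add: cong_iff_dvd_diff)
  next
    case False
    hence "q = 1" using that by (auto split: if_splits)
    thus ?thesis by simp
  qed
  hence "{q. q dvd n \<and> [k = 1] (mod int q)} = ?A \<union> ?B"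
    using small by fastforce
  moreover have "?A \<inter> ?B = {}" using small by fastforce
  ultimately have "cong_one_count n k = card ?A + card ?B"
    unfolding cong_one_count_def using fin by (simp add: card_Un_disjoint)
  thus ?thesis by (simp add: lambda_count_def rho_def)
qed

text \<open>Cancelling the unit \<open>k\<close> from n | 2k would leave n | 2. Hence each class up
  to sign consists of two distinct units.\<close>

lemma not_cong_uminus:
  assumes "n \<ge> 3" "coprime k (int n)"
  shows "\<not> [k = - k] (mod int n)"
proof
  assume "[k = - k] (mod int n)"
  hence "int n dvd 2 * k" by (simp add: cong_iff_dvd_diff)
  hence "int n dvd 2" using assms(2) by (simp add: coprime_commute coprime_dvd_mult_left_iff)
  thus False using assms(1) zdvd_imp_le[of "int n" 2] by simp
qed

lemma rep_system_unique:
  assumes "n \<ge> 3" "rep_system n R" "r \<in> R" "r' \<in> R" "[r = r'] (mod int n) \<or> [r = - r'] (mod int n)"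
  shows "r = r'"
proof -
  have "coprime r (int n)" using assms by (simp add: rep_system_def)
  hence "\<exists>!s. s \<in> R \<and> ([r = s] (mod int n) \<or> [r = - s] (mod int n))"
    using assms(2) unfolding rep_system_iff[OF assms(1)] by simp
  moreover have "[r = r] (mod int n)" by simp
  ultimately show ?thesis using assms(3-5) by blast
qed

text \<open>Each unit is congruent to s r for exactly one representative r and one sign s, and
  \<open>f\<close> ignores the sign.\<close>

lemma sum_unit_reps_rep_system:
  fixes f :: "int \<Rightarrow> 'a :: comm_semiring_1"
  assumes n: "n \<ge> 3" and R: "rep_system n R"
    and f: "\<And>k k'. coprime k (int n) \<Longrightarrow> [k = k'] (mod int n) \<or> [k = - k'] (mod int n) \<Longrightarrow> f k = f k'"
  shows "(\<Sum>u\<in>unit_reps n. f u) = 2 * (\<Sum>r\<in>R. f r)"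
proof -
  let ?g = "\<lambda>(r, s). (s * r) mod int n"
  have cop: "coprime r (int n)" if "r \<in> R" for r using R that by (simp add: rep_system_def)
  have bij: "bij_betw ?g (R \<times> {1, -1}) (unit_reps n)"
    unfolding bij_betw_def
  proof (intro conjI)
    show "inj_on ?g (R \<times> {1, -1})"
    proof (rule inj_onI, clarify)
      fix r s r' s' :: int
      assume *: "r \<in> R" "r' \<in> R" "s \<in> {1, -1}" "s' \<in> {1, -1}" "s * r mod int n = s' * r' mod int n"
      hence c: "[s * r = s' * r'] (mod int n)" by (simp add: cong_def)
      \<comment> \<open>Signs square to 1, so multiplying by s brings both signs to the
        right.\<close>
      have "[r = s * s' * r'] (mod int n)"
        using cong_scalar_left[OF c, of s] *(3) by auto
      hence "[r = r'] (mod int n) \<or> [r = - r'] (mod int n)" using *(3,4) by auto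
      hence r: "r = r'" using rep_system_unique[OF n R *(1,2)] by blast
      have "s = s'"
      proof (rule ccontr)
        assume "s \<noteq> s'"
        hence "s * s' = -1" using *(3,4) by auto
        thus False using \<open>[r = s * s' * r'] (mod int n)\<close> not_cong_uminus[OF n cop[OF *(1)]] r by simp
      qed
      thus "r = r' \<and> s = s'" using r by blast
    qed
    show "?g ` (R \<times> {1, -1}) = unit_reps n"
    proof (intro equalityI subsetI)
      fix u assume "u \<in> ?g ` (R \<times> {1, -1})"
      then obtain r s where "r \<in> R" "s \<in> {1, -1}" "u = (s * r) mod int n" by auto
      thus "u \<in> unit_reps n" using n cop[of r] mod_in_unit_reps[of n "s * r"] by auto
    next
      fix u assume u: "u \<in> unit_reps n"
      then obtain r where r: "r \<in> R" "[u = r] (mod int n) \<or> [u = - r] (mod int n)"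
        using R coprime_unit_reps[OF u] unfolding rep_system_iff[OF n] by auto
      then obtain s where s: "s \<in> {1, -1}" "[u = s * r] (mod int n)" by force
      have "u = ?g (r, s)" using s(2) u by (simp add: unit_reps_def cong_def)
      thus "u \<in> ?g ` (R \<times> {1, -1})" using r(1) s(1) by blast
    qed
  qed
  have "(\<Sum>u\<in>unit_reps n. f u) = (\<Sum>x\<in>R \<times> {1, -1}. f (?g x))"
    by (rule sum.reindex_bij_betw[OF bij, symmetric])
  also have "\<dots> = (\<Sum>r\<in>R. \<Sum>s\<in>{1, -1}. f (?g (r, s)))"
    by (simp only: sum.cartesian_product) (simp add: case_prod_unfold)
  also have "\<dots> = (\<Sum>r\<in>R. 2 * f r)"
  proof (rule sum.cong[OF refl])
    fix r assume "r \<in> R"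
    have "f (?g (r, s)) = f r" if "s \<in> {1, -1}" for s
    proof (rule f[OF cop[OF \<open>r \<in> R\<close>], THEN sym])
      show "[r = ?g (r, s)] (mod int n) \<or> [r = - ?g (r, s)] (mod int n)"
        using that by (auto simp: cong_def mod_minus_eq)
    qed
    hence "f (?g (r, 1)) = f r" "f (?g (r, -1)) = f r" by blast+
    thus "(\<Sum>s\<in>{1, -1}. f (?g (r, s))) = 2 * f r" by (simp add: mult_2)
  qed
  finally show ?thesis by (simp add: sum_distrib_left)
qed

lemma cong_inverse_unique:
  fixes k x y m :: int
  assumes "[k * x = 1] (mod m)" "[k * y = 1] (mod m)"
  shows "[x = y] (mod m)"
proof -
  have "coprime k m" using assms(1) coprime_iff_invertible_int by blast
  moreover have "[k * x = k * y] (mod m)" using assms by (simp add: cong_def)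
  ultimately show ?thesis by (simp add: cong_mult_lcancel)
qed

text \<open>The choice of inverses made by \<open>star\<close> is arbitrary, but inverses are unique
  modulo \<open>n\<close>, so congruence up to sign survives it.\<close>

lemma star_cong:
  assumes star: "\<And>k. coprime k (int n) \<Longrightarrow> [k * star k = 1] (mod int n)"
    and k: "coprime k (int n)" and kk: "[k = k'] (mod int n) \<or> [k = - k'] (mod int n)"
  shows "[star k = star k'] (mod int n) \<or> [star k = - star k'] (mod int n)"
  using kk
proof
  assume c: "[k = k'] (mod int n)"
  hence "coprime k' (int n)" using k by (metis cong_imp_coprime)
  hence "[k * star k' = 1] (mod int n)"
    using cong_trans[OF cong_scalar_right[OF c] star] by blast
  thus ?thesis using cong_inverse_unique star[OF k] by blast
next
  assume c: "[k = - k'] (mod int n)"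
  hence "coprime (- k') (int n)" using k by (metis cong_imp_coprime)
  hence "[k' * star k' = 1] (mod int n)" using star by simp
  moreover have "[k * - star k' = k' * star k'] (mod int n)"
    using cong_scalar_right[OF c, of "- star k'"] by simp
  ultimately have "[k * - star k' = 1] (mod int n)" using cong_trans by blast
  thus ?thesis using cong_inverse_unique star[OF k] by blast
qed

text \<open>Each cosine is a sum of two conjugate characters. The product has the four frequencies
  \<plusminus>(t + i) and \<plusminus>(t - i), which pair up because Ramanujan sums are
  even.\<close>

lemma sum_cosine_c_product:
  assumes "n > 0"
  shows "(\<Sum>s\<in>unit_reps n. of_real (cosine_c n (i * s)) * of_real (cosine_c n (t * s))) =
    2 * (ramanujan_sum n (t + i) + ramanujan_sum n (t - i))"
proof -
  have "of_real (cosine_c n (i * s)) * of_real (cosine_c n (t * s)) =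
    add_char n (s * (t + i)) + add_char n (s * - (t + i)) + add_char n (s * (t - i)) + add_char n (s * - (t - i))" for s
    unfolding cosine_c_conv_add_char distrib_left distrib_right add_char_add[symmetric]
    by (simp add: algebra_simps)
  hence "(\<Sum>s\<in>unit_reps n. of_real (cosine_c n (i * s)) * of_real (cosine_c n (t * s))) =
    ramanujan_sum n (t + i) + ramanujan_sum n (- (t + i)) + ramanujan_sum n (t - i) + ramanujan_sum n (- (t - i))"
    by (simp only: sum.distrib ramanujan_sum_def)
  thus ?thesis
    unfolding ramanujan_sum_uminus[OF assms] by simp
qed

section \<open>The product of the two matrices for square-free \<open>n\<close>\<close>

lemma cong_pm_scalar:
  fixes k k' m :: int
  assumes "[k = k'] (mod m) \<or> [k = - k'] (mod m)"
  shows "[k * x = k' * x] (mod m) \<or> [k * x = - (k' * x)] (mod m)"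
  using assms cong_scalar_right[of k k' m x] cong_scalar_right[of k "- k'" m x] by auto

lemma cosine_c_cong_pm:
  "[k = k'] (mod int n) \<or> [k = - k'] (mod int n) \<Longrightarrow> cosine_c n k = cosine_c n k'"
  using cosine_c_cong[of k k' n] cosine_c_cong[of k "- k'" n] by (auto simp: cosine_c_uminus)

text \<open>At l k this is the coefficient of \<open>cosine_c n l\<close> in
  \<open>cosine_c_hat n R k\<close>, up to the factor 1/n, with the constant \<open>rho n\<close>
  absorbed. Its values are complex because it will be multiplied by Ramanujan sums.\<close>

definition cong_pm_count :: "nat \<Rightarrow> int \<Rightarrow> complex" where
  "cong_pm_count n k = of_nat (cong_one_count n k) + of_nat (cong_one_count n (- k))"

lemma cong_pm_count_cong_pm:
  assumes "[k = k'] (mod int n) \<or> [k = - k'] (mod int n)"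
  shows "cong_pm_count n k = cong_pm_count n k'"
  using assms
proof
  assume "[k = k'] (mod int n)"
  moreover from this have "[- k = - k'] (mod int n)" by (rule cong_uminus)
  ultimately show ?thesis
    unfolding cong_pm_count_def using periodic_modD[OF periodic_cong_one_count] by metis
next
  assume "[k = - k'] (mod int n)"
  moreover from this have "[- k = k'] (mod int n)" using cong_uminus[of k "- k'"] by simp
  ultimately show ?thesis
    unfolding cong_pm_count_def using periodic_modD[OF periodic_cong_one_count] by (metis add.commute)
qed

text \<open>The summand is even in l, so the sum over the representatives is half the sum over all
  units, whence the denominator 2n.\<close>

lemma cosine_c_hat_conv_unit_reps:
  assumes n: "n \<ge> 3" and R: "rep_system n R" and k: "coprime k (int n)"
  shows "of_real (cosine_c_hat n R k) =
    (\<Sum>l\<in>unit_reps n. cong_pm_count n (l * k) * of_real (cosine_c n l)) / (2 * of_nat n)"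
proof -
  have eq: "of_nat (lambda_count n (l * k) + lambda_count n (- l * k) + rho n) = cong_pm_count n (l * k)"
    if "l \<in> R" for l
  proof -
    have "coprime l (int n)" using R that by (simp add: rep_system_def)
    hence "2 * (lambda_count n (l * k) + lambda_count n (- l * k) + rho n) =
      2 * (cong_one_count n (l * k) + cong_one_count n (- (l * k)))"
      using k n cong_one_count_conv_lambda_count[of n "l * k"]
        cong_one_count_conv_lambda_count[of n "- (l * k)"] by simp
    hence "lambda_count n (l * k) + lambda_count n (- l * k) + rho n =
      cong_one_count n (l * k) + cong_one_count n (- (l * k))"
      unfolding mult_cancel1 by simp
    thus ?thesis by (simp only: cong_pm_count_def of_nat_add)
  qed
  have "complex_of_real (cosine_c_hat n R k) =
      (\<Sum>l\<in>R. of_nat (lambda_count n (l * k) + lambda_count n (- l * k) + rho n) * of_real (cosine_c n l)) / of_nat n"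
    by (simp add: cosine_c_hat_def)
  also have "\<dots> = (\<Sum>l\<in>R. cong_pm_count n (l * k) * of_real (cosine_c n l)) / of_nat n"
    using eq by (intro arg_cong2[where f = "(/)"] sum.cong refl) simp
  also have "\<dots> = (\<Sum>l\<in>unit_reps n. cong_pm_count n (l * k) * of_real (cosine_c n l)) / (2 * of_nat n)"
  proof -
    have "(\<Sum>l\<in>unit_reps n. cong_pm_count n (l * k) * of_real (cosine_c n l)) =
      2 * (\<Sum>l\<in>R. cong_pm_count n (l * k) * of_real (cosine_c n l))"
      using n R
    proof (rule sum_unit_reps_rep_system)
      fix l l' assume l: "[l = l'] (mod int n) \<or> [l = - l'] (mod int n)"
      show "cong_pm_count n (l * k) * of_real (cosine_c n l) = cong_pm_count n (l' * k) * of_real (cosine_c n l')"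
        using cosine_c_cong_pm[OF l] cong_pm_count_cong_pm[OF cong_pm_scalar[OF l]] by simp
    qed
    thus ?thesis by simp
  qed
  finally show ?thesis .
qed

lemma sum_cosine_c_cosine_c_hat:
  assumes n: "n \<ge> 3" and R: "rep_system n R" and sq: "squarefree n"
    and star: "\<And>k. coprime k (int n) \<Longrightarrow> [k * star k = 1] (mod int n)"
    and i: "i \<in> R" and k: "k \<in> R"
  shows "(\<Sum>m\<in>R. cosine_c n (i * star m) * cosine_c_hat n R (m * star k)) = (if i = k then 1 else 0)"
proof -
  have n0: "n > 0" using n by simp
  have cop: "coprime r (int n)" if "r \<in> R" for r using R that by (simp add: rep_system_def)
  have cop_star: "coprime (star r) (int n)" if "coprime r (int n)" for r
    using star[OF that] by (metis coprime_iff_invertible_int mult.commute)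
  define e where "e = star k"
  have e: "coprime e (int n)" unfolding e_def by (intro cop_star cop k)
  define c :: "int \<Rightarrow> complex" where "c = (\<lambda>x. of_real (cosine_c n x))"
  have c_cong: "c x = c y" if "[x = y] (mod int n) \<or> [x = - y] (mod int n)" for x y
    unfolding c_def using cosine_c_cong_pm[OF that] by simp
  \<comment> \<open>Up to the factor 1/(2n), the summand of the matrix product at m will turn out to
    depend on m only through s = \<open>star m\<close>; \<open>H\<close> is that function of
    s.\<close>
  define H where "H = (\<lambda>s. c (i * s) * (\<Sum>t\<in>unit_reps n. cong_pm_count n (t * e) * c (t * s)))"
  have H_cong: "H x = H y" if "[x = y] (mod int n) \<or> [x = - y] (mod int n)" for x y
  proof -
    have "c (z * x) = c (z * y)" for z
      using c_cong[OF cong_pm_scalar[OF that, of z]] by (simp add: mult.commute)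
    thus ?thesis by (simp add: H_def)
  qed
  have hat: "c (i * star m) * of_real (cosine_c_hat n R (m * star k)) = H (star m) / (2 * of_nat n)"
    if m: "m \<in> R" for m
  proof -
    let ?f = "\<lambda>l. cong_pm_count n (l * (m * e)) * c l"
    have per: "periodic_mod n ?f"
      unfolding periodic_mod_def
      by (intro allI impI arg_cong2[where f = "(*)"] c_cong cong_pm_count_cong_pm disjI1 cong_scalar_right)
    \<comment> \<open>Substituting l = t \<open>star m\<close> cancels m in the argument of the
      weight and moves \<open>star m\<close> into the cosine.\<close>
    have "(\<Sum>l\<in>unit_reps n. ?f l) = (\<Sum>t\<in>unit_reps n. ?f (t * star m))"
      using sum_unit_reps_mult[OF n0 per cop_star[OF cop[OF m]]] by simp
    also have "\<dots> = (\<Sum>t\<in>unit_reps n. cong_pm_count n (t * e) * c (t * star m))"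
    proof (intro sum.cong refl arg_cong2[where f = "(*)"] cong_pm_count_cong_pm disjI1)
      fix t
      have "[(t * e) * (m * star m) = (t * e) * 1] (mod int n)"
        by (intro cong_scalar_left star cop m)
      thus "[t * star m * (m * e) = t * e] (mod int n)" by (simp add: mult_ac)
    qed
    finally have "(\<Sum>l\<in>unit_reps n. ?f l) = (\<Sum>t\<in>unit_reps n. cong_pm_count n (t * e) * c (t * star m))" .
    moreover have "coprime (m * star k) (int n)" using cop[OF m] e by (simp add: e_def)
    ultimately show ?thesis
      using cosine_c_hat_conv_unit_reps[OF n R, of "m * star k"] by (simp add: H_def c_def e_def)
  qed
  have "of_real (\<Sum>m\<in>R. cosine_c n (i * star m) * cosine_c_hat n R (m * star k)) =
      (\<Sum>m\<in>R. c (i * star m) * of_real (cosine_c_hat n R (m * star k)))"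
    by (simp add: c_def)
  also have "\<dots> = (\<Sum>m\<in>R. H (star m)) / (2 * of_nat n)"
    unfolding sum_divide_distrib by (intro sum.cong refl hat)
  also have "(\<Sum>m\<in>R. H (star m)) = (\<Sum>u\<in>unit_reps n. H (star u)) / 2"
    using sum_unit_reps_rep_system[OF n R, of "\<lambda>m. H (star m)"] H_cong[OF star_cong[of n star, OF star]]
    by simp
  also have "(\<Sum>u\<in>unit_reps n. H (star u)) = (\<Sum>s\<in>unit_reps n. H s)"
    by (rule sum_unit_reps_inverse[OF n0 _ star]) (use H_cong in \<open>auto simp: periodic_mod_def\<close>)
  also have "\<dots> = (\<Sum>t\<in>unit_reps n. cong_pm_count n (t * e) * (\<Sum>s\<in>unit_reps n. c (i * s) * c (t * s)))"
    unfolding H_def sum_distrib_left by (subst sum.swap) (simp add: mult_ac)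
  also have "\<dots> = (\<Sum>t\<in>unit_reps n. cong_pm_count n (t * e) * (2 * (ramanujan_sum n (t + i) + ramanujan_sum n (t - i))))"
    unfolding c_def sum_cosine_c_product[OF n0] ..
  also have "\<dots> = 2 * ((\<Sum>t\<in>unit_reps n. cong_pm_count n (t * e) * ramanujan_sum n (t + i)) +
      (\<Sum>t\<in>unit_reps n. cong_pm_count n (t * e) * ramanujan_sum n (t - i)))"
    by (simp add: sum_distrib_left sum.distrib distrib_left mult_ac)
  \<comment> \<open>Replacing t by -t turns the shift by i into the shift by -i, as weight and
    Ramanujan sum are even; the two sums are therefore equal.\<close>
  also have "(\<Sum>t\<in>unit_reps n. cong_pm_count n (t * e) * ramanujan_sum n (t + i)) =
      (\<Sum>t\<in>unit_reps n. cong_pm_count n (- t * e) * ramanujan_sum n (- t + i))"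
    by (rule sum_unit_reps_uminus[OF n0, symmetric])
       (unfold periodic_mod_def, intro allI impI arg_cong2[where f = "(*)"] cong_pm_count_cong_pm disjI1
          periodic_modD[OF periodic_ramanujan_sum[OF n0]] cong_scalar_right cong_add cong_refl)
  also have "\<dots> = (\<Sum>t\<in>unit_reps n. cong_pm_count n (t * e) * ramanujan_sum n (t - i))"
  proof (rule sum.cong[OF refl])
    fix t
    have "ramanujan_sum n (- t + i) = ramanujan_sum n (t - i)"
      using ramanujan_sum_uminus[OF n0, of "t - i"] by simp
    thus "cong_pm_count n (- t * e) * ramanujan_sum n (- t + i) = cong_pm_count n (t * e) * ramanujan_sum n (t - i)"
      by (simp add: cong_pm_count_def add.commute)
  qed
  also have "\<dots> = (\<Sum>t\<in>unit_reps n. of_nat (cong_one_count n (t * e)) * ramanujan_sum n (t - i)) +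
      (\<Sum>t\<in>unit_reps n. of_nat (cong_one_count n (t * - e)) * ramanujan_sum n (t - i))"
    by (simp add: cong_pm_count_def distrib_right sum.distrib)
  also have "\<dots> = (if [e * i = 1] (mod int n) then of_nat n else 0) + (if [- e * i = 1] (mod int n) then of_nat n else 0)"
    using convolution_squarefree[OF sq e cop[OF i]] convolution_squarefree[OF sq _ cop[OF i], of "- e"] e by simp
  also have "[e * i = 1] (mod int n) \<longleftrightarrow> i = k"
  proof
    have ek: "[e * k = 1] (mod int n)" using star[OF cop[OF k]] by (simp add: e_def mult.commute)
    thus "i = k \<Longrightarrow> [e * i = 1] (mod int n)" by simp
    assume "[e * i = 1] (mod int n)"
    thus "i = k" using cong_inverse_unique[OF _ ek] rep_system_unique[OF n R i k] by blast
  qed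
  \<comment> \<open>This congruence would make i congruent to -k. Uniqueness of representatives then
    gives i = k, so k would be congruent to its own negative.\<close>
  also have "[- e * i = 1] (mod int n) \<longleftrightarrow> False"
  proof
    assume *: "[- e * i = 1] (mod int n)"
    have ek: "[- e * - k = 1] (mod int n)" using star[OF cop[OF k]] by (simp add: e_def mult.commute)
    have ik: "[i = - k] (mod int n)" using cong_inverse_unique[OF * ek] .
    hence "i = k" using rep_system_unique[OF n R i k] by blast
    thus False using ik not_cong_uminus[OF n cop[OF k]] by simp
  qed simp
  finally have "complex_of_real (\<Sum>m\<in>R. cosine_c n (i * star m) * cosine_c_hat n R (m * star k)) =
      of_real (if i = k then 1 else 0)"
    using n0 by (simp split: if_splits)
  thus ?thesis by (simp only: of_real_eq_iff)
qed

section \<open>A kernel vector when \<open>n\<close> is not square-free\<close>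

lemma sum_cosine_c_progression:
  assumes "p > 0" "q > 0" "\<not> int p dvd j"
  shows "(\<Sum>s<p. cosine_c (p * q) (j * (1 + int s * int q))) = 0"
proof -
  \<comment> \<open>The dependence on s is a character modulo \<open>p\<close> evaluated at s x, so
    a full character sum modulo \<open>p\<close> factors out.\<close>
  have eq: "(\<Sum>s<p. add_char (p * q) (x * (1 + int s * int q))) = 0" if "\<not> int p dvd x" for x
  proof -
    have "add_char (p * q) (x * (1 + int s * int q)) = add_char (p * q) x * add_char p (int s * x)" for s
    proof -
      have "x * (1 + int s * int q) = x + int q * (int s * x)" by (simp add: algebra_simps)
      thus ?thesis
        using add_char_mult_cancel[OF assms(2), of p "int s * x"] by (simp add: add_char_add mult.commute[of p])
    qed
    thus ?thesis using sum_add_char[OF assms(1), of x] that by (simp add: sum_distrib_left[symmetric])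
  qed
  have "of_real (\<Sum>s<p. cosine_c (p * q) (j * (1 + int s * int q))) = (0 :: complex)"
    using eq[of j] eq[of "- j"] assms(3) by (simp add: cosine_c_conv_add_char sum.distrib)
  thus ?thesis by (simp only: of_real_eq_0_iff)
qed

lemma cosine_matrix_kernel:
  assumes n: "n \<ge> 3" and R: "finite R" "rep_system n R" and sq: "\<not> squarefree n"
    and star: "\<And>k. coprime k (int n) \<Longrightarrow> [k * star k = 1] (mod int n)"
  obtains v where "\<exists>r\<in>R. v r \<noteq> (0 :: real)" "\<And>i. i \<in> R \<Longrightarrow> (\<Sum>r\<in>R. cosine_c n (i * star r) * v r) = 0"
proof -
  obtain x where x: "x ^ 2 dvd n" "\<not> is_unit x" using sq by (auto simp: squarefree_def)
  then obtain p where p: "prime p" "p dvd x" by (metis nat_dvd_1_iff_1 prime_factor_nat)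
  have "p ^ 2 dvd n" using x(1) p(2) by (meson dvd_power_same dvd_trans)
  then obtain w where w: "n = p * (p * w)" by (metis dvdE mult.assoc power2_eq_square)
  define q where "q = p * w"
  have nq: "n = p * q" using w by (simp add: q_def)
  have pos: "p > 0" "q > 0" using n nq by (auto intro: Nat.gr0I)
  have cop: "coprime r (int n)" if "r \<in> R" for r using R that by (simp add: rep_system_def)
  define y where "y = (\<lambda>s. 1 + int s * int q)"
  \<comment> \<open>Here the square of \<open>p\<close> dividing \<open>n\<close> matters: q = n/p
    is still a multiple of \<open>p\<close>, so being 1 modulo \<open>q\<close> implies being
    coprime to \<open>p\<close> as well.\<close>
  have cop_y: "coprime (y s) (int n)" for s
  proof -
    have "coprime (y s) (int q)"
      unfolding coprime_iff_invertible_int by (rule exI[of _ 1]) (simp add: y_def cong_iff_dvd_diff)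
    moreover from this have "coprime (y s) (int p)"
      by (simp add: q_def)
    ultimately show ?thesis by (simp add: nq)
  qed
  \<comment> \<open>\<open>P r s\<close> says that \<open>y s\<close> is inverse to r up to sign, so
    that \<open>star r\<close> may be replaced by \<open>y s\<close> inside a cosine.\<close>
  define P where "P = (\<lambda>r s. [r * y s = 1] (mod int n) \<or> [r * y s = - 1] (mod int n))"
  have uniq: "\<exists>!r. r \<in> R \<and> P r s" for s
  proof -
    have st: "[y s * star (y s) = 1] (mod int n)" by (rule star[OF cop_y])
    have "coprime (star (y s)) (int n)"
      using st by (metis coprime_iff_invertible_int mult.commute)
    hence "\<exists>!r. r \<in> R \<and> ([star (y s) = r] (mod int n) \<or> [star (y s) = - r] (mod int n))"
      using R(2) unfolding rep_system_iff[OF n] by blast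
    moreover have "[star (y s) = r] (mod int n) \<longleftrightarrow> [r * y s = 1] (mod int n)" for r
      using cong_inverse_unique[OF st, of r] cong_scalar_left[of "star (y s)" r "int n" "y s"] st
      by (metis cong_sym cong_trans mult.commute)
    moreover have "[star (y s) = - r] (mod int n) \<longleftrightarrow> [r * y s = - 1] (mod int n)" for r
    proof -
      have "[star (y s) = - r] (mod int n) \<longleftrightarrow> [- r * y s = 1] (mod int n)" by fact
      also have "\<dots> \<longleftrightarrow> [r * y s = - 1] (mod int n)"
        using cong_uminus[of "- r * y s" 1 "int n"] cong_uminus[of "r * y s" "- 1" "int n"] by auto
      finally show ?thesis .
    qed
    ultimately show ?thesis unfolding P_def by simp
  qed
  have c_eq: "cosine_c n (i * star r) = cosine_c n (i * y s)" if "r \<in> R" "P r s" for i r s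
  proof -
    have r: "[r * star r = 1] (mod int n)" using star cop that(1) by blast
    have "[star r = y s] (mod int n) \<or> [star r = - y s] (mod int n)"
      using that(2) unfolding P_def
    proof
      assume "[r * y s = - 1] (mod int n)"
      hence "[r * - y s = 1] (mod int n)" using cong_uminus[of "r * y s" "- 1"] by simp
      thus ?thesis using cong_inverse_unique[OF r] by blast
    qed (use cong_inverse_unique[OF r] in blast)
    hence "[star r * i = y s * i] (mod int n) \<or> [star r * i = - (y s * i)] (mod int n)"
      by (rule cong_pm_scalar)
    thus ?thesis by (simp add: mult.commute cosine_c_cong_pm)
  qed
  \<comment> \<open>Each s belongs to exactly one representative, so weighting by \<open>v\<close>
    turns a sum over representatives into a sum over s < p.\<close>
  define v :: "int \<Rightarrow> real" where "v = (\<lambda>r. \<Sum>s<p. if P r s then 1 else 0)"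
  show ?thesis
  proof (rule that[of v])
    \<comment> \<open>The summands of \<open>v\<close> are nonnegative, so the representative
      belonging to s = 0 has a positive entry.\<close>
    obtain r where r: "r \<in> R" "P r 0" using uniq[of 0] by blast
    have "v r \<ge> (\<Sum>s\<in>{0}. if P r s then 1 else 0)"
      unfolding v_def using pos by (intro sum_mono2) auto
    hence "v r \<noteq> 0" using r(2) by simp
    thus "\<exists>r\<in>R. v r \<noteq> 0" using r(1) by blast
  next
    fix i assume i: "i \<in> R"
    have "(\<Sum>r\<in>R. cosine_c n (i * star r) * v r) = (\<Sum>s<p. \<Sum>r\<in>R. cosine_c n (i * star r) * (if P r s then 1 else 0))"
      unfolding v_def sum_distrib_left by (rule sum.swap)
    also have "\<dots> = (\<Sum>s<p. cosine_c n (i * y s))"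
    proof (rule sum.cong[OF refl])
      fix s
      obtain r where r: "r \<in> R" "P r s" "\<And>r'. r' \<in> R \<Longrightarrow> P r' s \<Longrightarrow> r' = r" using uniq[of s] by blast
      have "(\<Sum>r'\<in>R. cosine_c n (i * star r') * (if P r' s then 1 else 0)) =
        (\<Sum>r'\<in>R. if r' = r then cosine_c n (i * y s) else 0)"
      proof (rule sum.cong[OF refl])
        fix r' assume r': "r' \<in> R"
        show "cosine_c n (i * star r') * (if P r' s then 1 else 0) = (if r' = r then cosine_c n (i * y s) else 0)"
        proof (cases "P r' s")
          case True
          thus ?thesis using r(3)[OF r' True] c_eq[OF r' True] by simp
        next
          case False
          hence "r' \<noteq> r" using r(2) by blast
          thus ?thesis using False by simp
        qed
      qed
      thus "(\<Sum>r'\<in>R. cosine_c n (i * star r') * (if P r' s then 1 else 0)) = cosine_c n (i * y s)"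
        using R(1) r(1) by simp
    qed
    also have "\<dots> = 0"
    proof -
      have "\<not> int p dvd i"
      proof
        assume "int p dvd i"
        hence "is_unit (int p)"
          using coprime_common_divisor[OF cop[OF i], of "int p"] nq by simp
        thus False using p(1) by auto
      qed
      thus ?thesis unfolding nq y_def using sum_cosine_c_progression[OF pos, of i] by simp
    qed
    finally show "(\<Sum>r\<in>R. cosine_c n (i * star r) * v r) = 0" .
  qed
qed

section \<open>From sums over representatives to matrices\<close>

lemma sum_nth_conv_sum_set:
  "distinct xs \<Longrightarrow> (\<Sum>i = 0..<length xs. f (xs ! i)) = (\<Sum>x\<in>set xs. f x)"
  by (rule sum.reindex_bij_betw) (simp add: bij_betw_nth atLeast0LessThan)

theorem theorem2:
  fixes n :: nat and rs :: "int list" and star :: "int \<Rightarrow> int"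
  assumes "n \<ge> 3"
    and "distinct rs"
    and "rep_system n (set rs)"
    and "\<And>k. coprime k (int n) \<Longrightarrow> [k * star k = 1] (mod int n)"
  shows "(invertible_mat (cosine_matrix n rs star) \<longleftrightarrow> squarefree n) \<and>
    (squarefree n \<longrightarrow>
      inverts_mat (cosine_matrix n rs star) (cosine_matrix_hat n rs star) \<and>
      inverts_mat (cosine_matrix_hat n rs star) (cosine_matrix n rs star))"
proof -
  let ?C = "cosine_matrix n rs star" and ?D = "cosine_matrix_hat n rs star" and ?N = "length rs"
  have C: "?C \<in> carrier_mat ?N ?N" and D: "?D \<in> carrier_mat ?N ?N"
    by (simp_all add: cosine_matrix_def cosine_matrix_hat_def)
  have inv: "inverts_mat ?C ?D \<and> inverts_mat ?D ?C" if sq: "squarefree n"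
  proof -
    have "?C * ?D = 1\<^sub>m ?N"
    proof (rule eq_matI)
      fix i j assume "i < dim_row (1\<^sub>m ?N :: real mat)" "j < dim_col (1\<^sub>m ?N :: real mat)"
      hence ij: "i < ?N" "j < ?N" by simp_all
      have "(?C * ?D) $$ (i, j) =
          (\<Sum>m = 0..<?N. cosine_c n (rs ! i * star (rs ! m)) * cosine_c_hat n (set rs) (rs ! m * star (rs ! j)))"
        using ij by (simp add: cosine_matrix_def cosine_matrix_hat_def scalar_prod_def)
      also have "\<dots> = (\<Sum>m\<in>set rs. cosine_c n (rs ! i * star m) * cosine_c_hat n (set rs) (m * star (rs ! j)))"
        by (rule sum_nth_conv_sum_set[OF assms(2)])
      also have "\<dots> = (if rs ! i = rs ! j then 1 else 0)"
        using ij by (intro sum_cosine_c_cosine_c_hat assms sq nth_mem)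
      also have "\<dots> = 1\<^sub>m ?N $$ (i, j)"
        using ij assms(2) by (simp add: nth_eq_iff_index_eq)
      finally show "(?C * ?D) $$ (i, j) = 1\<^sub>m ?N $$ (i, j)" .
    qed (use C D in auto)
    \<comment> \<open>For square matrices over a field a right inverse is also a left inverse, so
      the other product needs no computation.\<close>
    moreover from this have "?D * ?C = 1\<^sub>m ?N" by (rule mat_mult_left_right_inverse[OF C D])
    ultimately show ?thesis using C D by (simp add: inverts_mat_def)
  qed
  have "squarefree n" if ci: "invertible_mat ?C"
  proof (rule ccontr)
    assume "\<not> squarefree n"
    then obtain v where v: "\<exists>r\<in>set rs. v r \<noteq> (0 :: real)"
      "\<And>i. i \<in> set rs \<Longrightarrow> (\<Sum>r\<in>set rs. cosine_c n (i * star r) * v r) = 0"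
      using cosine_matrix_kernel[OF assms(1) finite_set assms(3) _ assms(4)] by blast
    define w where "w = vec ?N (\<lambda>i. v (rs ! i))"
    have w: "w \<in> carrier_vec ?N" by (simp add: w_def)
    have Cw: "?C *\<^sub>v w = 0\<^sub>v ?N"
    proof (rule eq_vecI)
      fix i assume "i < dim_vec (0\<^sub>v ?N :: real vec)"
      hence i: "i < ?N" by simp
      have "(?C *\<^sub>v w) $ i = (\<Sum>j = 0..<?N. cosine_c n (rs ! i * star (rs ! j)) * v (rs ! j))"
        using i by (simp add: cosine_matrix_def w_def scalar_prod_def)
      also have "\<dots> = (\<Sum>r\<in>set rs. cosine_c n (rs ! i * star r) * v r)"
        by (rule sum_nth_conv_sum_set[OF assms(2)])
      also have "\<dots> = 0" using i v(2) by simp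
      finally show "(?C *\<^sub>v w) $ i = 0\<^sub>v ?N $ i" using i by simp
    qed (use C in simp)
    obtain B where B: "inverts_mat B ?C" "inverts_mat ?C B"
      using ci by (auto simp: invertible_mat_def)
    have CB: "?C * B = 1\<^sub>m ?N" and BC: "B * ?C = 1\<^sub>m (dim_row B)"
      using B C by (simp_all add: inverts_mat_def)
    \<comment> \<open>\<open>inverts_mat\<close> does not fix the dimensions of B; they are read off
      by comparing the two products with identity matrices.\<close>
    have "dim_col B = ?N" using arg_cong[OF CB, of dim_col] by simp
    moreover have "dim_row B = ?N" using arg_cong[OF BC, of dim_col] C by simp
    ultimately have Bc: "B \<in> carrier_mat ?N ?N" by auto
    have "w = (B * ?C) *\<^sub>v w" using BC w \<open>dim_row B = ?N\<close> by simp
    also have "\<dots> = B *\<^sub>v (?C *\<^sub>v w)" by (rule assoc_mult_mat_vec[OF Bc C w])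
    also have "\<dots> = 0\<^sub>v ?N" unfolding Cw using Bc by auto
    finally have w0: "w = 0\<^sub>v ?N" .
    obtain i where "i < ?N" "v (rs ! i) \<noteq> 0" using v(1) by (metis in_set_conv_nth)
    hence "w $ i \<noteq> 0" "(0\<^sub>v ?N :: real vec) $ i = 0" by (simp_all add: w_def)
    thus False using w0 by simp
  qed
  moreover have "invertible_mat ?C" if "squarefree n"
    using inv[OF that] C by (auto simp: invertible_mat_def)
  ultimately show ?thesis using inv by blast
qed

end
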